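(* Let $k$ and $n$ be positive integers. If $2<\frac{n}{k}\le 3$, then $$\nu_k(K_n)=\frac12\,(n-3)(n-2k).$$
   Context: A $k$-page book consists of $k$ halfplanes (pages) with a common boundary line (the spine). A $k$-page book drawing of a graph $G$ is a drawing of $G$ in a $k$-page book in which all vertices lie on the spine and edges do not cross the spine (each edge lies in one page). The $k$-page book crossing number $\nu_k(G)$ is the minimum number of edge-crossings over all $k$-page book drawings of $G$. Equivalently (convex model), $\nu_k(K_n)$ is the minimum, over all colorings of the edges of the complete geometric graph on the $n$ vertices of a convex polygon with $k$ colors, of the number of monochromatic crossings, i.e. pairs of edges of the same color that cross in their interiors. $K_n$ is the complete graph on $n$ vertices. *)

theory Defs
  imports "HOL-Analysis.Analysis"
begin

text \<open>
  A graph is given by a vertex set \<open>V\<close> and a set \<open>E\<close> of edges, each edge being a two-element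
  subset of \<open>V\<close>. The \<open>k\<close> pages of a book are numbered \<open>0, \<dots>, k - 1\<close>. Every page is a copy of the
  closed upper half-plane of the complex numbers, and all copies are glued along the real axis,
  which is the spine. A point of the book off the spine is thus a page number together with a
  complex number of positive imaginary part.
\<close>

record 'a drawing =
  spine_pos :: "'a \<Rightarrow> real"
  page_of :: "'a set \<Rightarrow> nat"
  curve :: "'a set \<Rightarrow> real \<Rightarrow> complex"

definition edge_interior :: "'a drawing \<Rightarrow> 'a set \<Rightarrow> complex set" where
  "edge_interior D e = curve D e ` {0<..<1}"

text \<open>
  Crossings are counted per pair of edges: a point lying on the interiors of several edges of the
  same page contributes one crossing for every pair of them, and a pair of edges contributes one
  crossing for every common interior point, touching points included.
\<close>

definition crossings :: "'a set set \<Rightarrow> 'a drawing \<Rightarrow> ('a set set \<times> complex) set" where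
  "crossings E D =
    {({e, f}, p) | e f p. e \<in> E \<and> f \<in> E \<and> e \<noteq> f \<and> page_of D e = page_of D f \<and>
                          p \<in> edge_interior D e \<inter> edge_interior D f}"

text \<open>
  The last condition is needed because \<open>card\<close> is \<open>0\<close> on infinite sets.
\<close>

definition book_drawing :: "nat \<Rightarrow> 'a set \<Rightarrow> 'a set set \<Rightarrow> 'a drawing \<Rightarrow> bool" where
  "book_drawing k V E D \<longleftrightarrow>
    inj_on (spine_pos D) V \<and>
    (\<forall>e\<in>E. page_of D e < k \<and>
           arc (curve D e) \<and>
           {pathstart (curve D e), pathfinish (curve D e)} = (\<lambda>v. of_real (spine_pos D v)) ` e \<and>
           edge_interior D e \<subseteq> {z. Im z > 0}) \<and>
    finite (crossings E D)"

definition book_crossing_number :: "nat \<Rightarrow> 'a set \<Rightarrow> 'a set set \<Rightarrow> nat" where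
  "book_crossing_number k V E =
    (LEAST m. \<exists>D. book_drawing k V E D \<and> card (crossings E D) = m)"

definition complete_edges :: "'a set \<Rightarrow> 'a set set" where
  "complete_edges V = {e. e \<subseteq> V \<and> card e = 2}"

definition nu_complete :: "nat \<Rightarrow> nat \<Rightarrow> nat" where
  "nu_complete k n = book_crossing_number k {..<n} (complete_edges {..<n})"

end

theory Submission
  imports Defs
begin

text \<open>
  Lower bound: a set of pairwise non-crossing diagonals of a convex \<open>n\<close>-gon has at most \<open>n - 3\<close> members,
  so deleting one diagonal per crossing shows that a page with \<open>m\<close> diagonals has at least
  \<open>m - (n - 3)\<close> crossings. Summed over \<open>k\<close> pages this gives
  \<open>n (n - 3) / 2 - k (n - 3) = (n - 3) (n - 2 k) / 2\<close>. For topological drawings, two edges of one page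
  with interleaved endpoints cross by Fashoda's theorem.

  Upper bound: draw all edges as semicircles and split the \<open>n\<close> parallel classes \<open>i + j \<equiv> c (mod n)\<close>
  into \<open>n - 2 k\<close> blocks of three and \<open>3 k - n\<close> blocks of two consecutive classes, one block per page.
  Two consecutive classes form a zigzag path without crossings; in a block of three, each diagonal of the
  first class crosses exactly one diagonal of the third.
\<close>

section \<open>Crossings among diagonals of a convex polygon\<close>

text \<open>A chord is a pair with its smaller endpoint first. The relation is oriented, the chord
  that starts first standing first, so \<open>interleaved_pairs\<close> contains each crossing
  once.\<close>

definition interleaved :: "nat \<times> nat \<Rightarrow> nat \<times> nat \<Rightarrow> bool" where
  "interleaved e f \<longleftrightarrow> fst e < fst f \<and> fst f < snd e \<and> snd e < snd f"

definition interleaved_pairs :: "(nat \<times> nat) set \<Rightarrow> ((nat \<times> nat) \<times> (nat \<times> nat)) set" where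
  "interleaved_pairs S = {(e, f) \<in> S \<times> S. interleaved e f}"

text \<open>The removed pair \<open>(0, n - 1)\<close> is the side of the polygon that wraps
  around.\<close>

definition diagonals :: "nat \<Rightarrow> (nat \<times> nat) set" where
  "diagonals n = {(i, j). i + 2 \<le> j \<and> j < n} - {(0, n - 1)}"

lemma finite_interleaved_pairs: "finite S \<Longrightarrow> finite (interleaved_pairs S)"
  unfolding interleaved_pairs_def by (rule finite_subset[of _ "S \<times> S"]) auto

lemma finite_diagonals: "finite (diagonals n)"
  unfolding diagonals_def by (rule finite_subset[of _ "{..n} \<times> {..n}"]) auto

lemma card_non_interleaved:
  assumes sub: "S \<subseteq> {(i, j). i + 2 \<le> j \<and> j < n}" and non: "interleaved_pairs S = {}"
  shows "card S \<le> n - 2"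
proof -
  \<comment> \<open>\<open>h (i, j)\<close> is the third corner of the triangle below \<open>(i, j)\<close> when the remaining chords
    form a triangulation; in every case distinct chords have distinct \<open>h\<close>.\<close>
  define K where "K e = {k. k < snd e \<and> ((fst e, k) \<in> S \<or> k = fst e + 1)}" for e :: "nat \<times> nat"
  define h where "h e = Max (K e)" for e
  have finK: "finite (K e)" for e
    unfolding K_def by (rule finite_subset[of _ "{..<snd e}"]) auto
  have hK: "h e \<in> K e" if "e \<in> S" for e
  proof -
    have "fst e + 1 \<in> K e" using sub that by (auto simp: K_def)
    then show ?thesis unfolding h_def using finK Max_in by blast
  qed
  have bounds: "fst e < h e \<and> h e < snd e" if "e \<in> S" for e
    using hK[OF that] sub unfolding K_def by auto
  \<comment> \<open>If \<open>e\<close> started strictly before \<open>f\<close>, then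
    \<open>h e = h f\<close> would exceed \<open>fst e + 1\<close>, so \<open>(fst e, h e)\<close>
    would be a chord of \<open>S\<close>; as \<open>h e\<close> lies strictly inside
    \<open>f\<close>, that chord would cross \<open>f\<close>.\<close>
  have left: "fst e = fst f" if "e \<in> S" "f \<in> S" "h e = h f" "fst e \<le> fst f" for e f
  proof (rule ccontr)
    assume "fst e \<noteq> fst f"
    then have lt: "fst e < fst f" using that by simp
    have "(fst e, h e) \<in> S"
      using hK[OF that(1)] lt bounds[OF that(2)] that(3) unfolding K_def by auto
    then have "((fst e, h e), f) \<in> interleaved_pairs S"
      using that lt bounds[OF that(2)] by (simp add: interleaved_pairs_def interleaved_def)
    then show False using non by simp
  qed
  \<comment> \<open>If \<open>e\<close> ended before \<open>f\<close> with the same start,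
    \<open>snd e\<close> would compete in the maximum defining \<open>h f\<close>, forcing
    \<open>h f\<close> beyond \<open>h e\<close>.\<close>
  have right: "snd f \<le> snd e" if "e \<in> S" "f \<in> S" "h e = h f" "fst e = fst f" for e f
  proof (rule ccontr)
    assume "\<not> snd f \<le> snd e"
    then have "snd e \<in> K f" using that by (cases e) (simp add: K_def)
    then have "snd e \<le> h f" unfolding h_def using finK Max_ge by blast
    then show False using bounds[OF that(1)] that(3) by simp
  qed
  have "inj_on h S"
  proof (rule inj_onI)
    fix e f assume *: "e \<in> S" "f \<in> S" "h e = h f"
    have "fst e = fst f" using left[of e f] left[of f e] * by (metis nle_le)
    moreover have "snd e = snd f"
      using right[of e f] right[of f e] * calculation by simp
    ultimately show "e = f" by (simp add: prod_eq_iff)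
  qed
  moreover have "h ` S \<subseteq> {1..<n - 1}"
    using bounds sub by fastforce
  ultimately have "card S \<le> card {1..<n - 1}" by (intro card_inj_on_le) auto
  then show ?thesis by simp
qed

text \<open>The side \<open>(0, n - 1)\<close> crosses no chord, so it can be added to
  \<open>S\<close> before applying the bound \<open>n - 2\<close>; this saves one.\<close>

lemma card_non_interleaved_diagonals:
  assumes "n \<ge> 3" "S \<subseteq> diagonals n" "interleaved_pairs S = {}"
  shows "card S \<le> n - 3"
proof -
  let ?T = "insert (0, n - 1) S"
  have "interleaved_pairs ?T = {}"
  proof (rule equals0I)
    fix x assume "x \<in> interleaved_pairs ?T"
    then obtain e f where "e \<in> ?T" "f \<in> ?T" "interleaved e f"
      by (auto simp: interleaved_pairs_def)
    moreover have "\<not> interleaved e f" if "e \<in> S" "f \<in> S"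
      using that assms(3) by (cases e, cases f) (auto simp: interleaved_pairs_def)
    moreover have "snd e \<le> n - 1" if "e \<in> S" for e
      using that assms(2) by (auto simp: diagonals_def)
    ultimately show False by (fastforce simp: interleaved_def)
  qed
  moreover have "?T \<subseteq> {(i, j). i + 2 \<le> j \<and> j < n}"
    using assms by (auto simp: diagonals_def)
  ultimately have "card ?T \<le> n - 2" by (rule card_non_interleaved[rotated])
  moreover have "card ?T = Suc (card S)"
    using assms finite_subset[OF assms(2) finite_diagonals]
    by (subst card_insert_disjoint) (auto simp: diagonals_def)
  ultimately show ?thesis by simp
qed

text \<open>Induction on the size of \<open>S\<close>: deleting one diagonal of a crossing pair
  lowers the left side by exactly one and the right side by at least one.\<close>

lemma card_le_interleaved_pairs:
  assumes "n \<ge> 3" "S \<subseteq> diagonals n"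
  shows "card S \<le> card (interleaved_pairs S) + (n - 3)"
  using assms(2)
proof (induction "card S" arbitrary: S rule: less_induct)
  case less
  have fin: "finite S" using less.prems finite_diagonals finite_subset by blast
  show ?case
  proof (cases "interleaved_pairs S = {}")
    case True
    then show ?thesis using card_non_interleaved_diagonals assms less.prems by simp
  next
    case False
    then obtain e f where ef: "(e, f) \<in> interleaved_pairs S" by auto
    then have e: "e \<in> S" by (simp add: interleaved_pairs_def)
    let ?S = "S - {e}"
    have "interleaved_pairs ?S \<subset> interleaved_pairs S"
      using ef by (auto simp: interleaved_pairs_def)
    then have "card (interleaved_pairs ?S) < card (interleaved_pairs S)"
      using finite_interleaved_pairs[OF fin] by (rule psubset_card_mono[rotated])
    moreover have "card S = Suc (card ?S)" using e fin by (metis card_Suc_Diff1)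
    moreover have "card ?S \<le> card (interleaved_pairs ?S) + (n - 3)"
      using less.prems calculation(2) by (intro less.hyps) auto
    ultimately show ?thesis by simp
  qed
qed

section \<open>Counting the diagonals and adding up the pages\<close>

lemma card_diagonals:
  assumes "n \<ge> 3"
  shows "2 * card (diagonals n) = n * (n - 3)"
proof -
  let ?A = "\<lambda>n. {(i, j). i + 2 \<le> j \<and> j < n} :: (nat \<times> nat) set"
  have fin: "finite (?A m)" for m by (rule finite_subset[of _ "{..m} \<times> {..m}"]) auto
  have *: "2 * card (?A (m + 2)) = (m + 1) * m" for m
  proof (induction m)
    case 0
    have "?A (0 + 2) = {}" by auto
    then have "card (?A (0 + 2)) = card ({} :: (nat \<times> nat) set)" by (rule arg_cong)
    then show ?case by simp
  next
    case (Suc m)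
    \<comment> \<open>The chords ending at the new last vertex \<open>m + 2\<close>; their starts
      are \<open>0\<close> to \<open>m\<close>, since the neighbour \<open>m + 1\<close> is
      excluded.\<close>
    let ?B = "(\<lambda>i. (i, m + 2)) ` {..m}"
    have eq: "?A (Suc m + 2) = ?A (m + 2) \<union> ?B" by auto
    have "card (?A (m + 2) \<union> ?B) = card (?A (m + 2)) + card ?B"
      by (rule card_Un_disjoint[OF fin]) auto
    moreover have "card ?B = m + 1" by (subst card_image) (auto simp: inj_on_def)
    ultimately have "2 * card (?A (Suc m + 2)) = 2 * card (?A (m + 2)) + 2 * (m + 1)"
      by (simp only: eq add_mult_distrib2)
    also have "\<dots> = (Suc m + 1) * Suc m" by (simp only: Suc) simp
    finally show ?case .
  qed
  obtain m where m: "n = m + 3" using assms le_Suc_ex by (metis add.commute)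
  have "card (diagonals n) = card (?A n) - 1"
    unfolding diagonals_def using m fin by (subst card_Diff_singleton) auto
  moreover have "2 * card (?A n) = (m + 2) * (m + 1)" using *[of "m + 1"] m
    by (simp add: numeral_eq_Suc)
  ultimately have "2 * card (diagonals n) = (m + 2) * (m + 1) - 2" by simp
  then show ?thesis by (simp add: m algebra_simps)
qed

text \<open>Sums \<open>card_le_interleaved_pairs\<close> over the color classes. The bound is
  negative when \<open>2 * k\<close> exceeds \<open>n > 3\<close>, hence the integers; doubling
  avoids the factor one half.\<close>

lemma card_monochromatic_ge:
  assumes "n \<ge> 3" and col: "\<And>e. e \<in> diagonals n \<Longrightarrow> col e < (k :: nat)"
  shows "int ((n - 3) * n) - int ((n - 3) * (2 * k))
    \<le> 2 * int (card {(e, f) \<in> interleaved_pairs (diagonals n). col e = col f})"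
proof -
  define P where "P c = {e \<in> diagonals n. col e = c}" for c
  have finP: "finite (P c)" for c using finite_diagonals by (simp add: P_def)
  have "card (\<Union>c<k. P c) = (\<Sum>c<k. card (P c))"
    by (rule card_UN_disjoint) (auto simp: P_def finite_diagonals)
  moreover have "(\<Union>c<k. P c) = diagonals n" using col by (auto simp: P_def)
  ultimately have D: "card (diagonals n) = (\<Sum>c<k. card (P c))" by simp
  have "card (\<Union>c<k. interleaved_pairs (P c)) = (\<Sum>c<k. card (interleaved_pairs (P c)))"
    by (rule card_UN_disjoint) (auto simp: finP finite_interleaved_pairs, auto simp: P_def interleaved_pairs_def)
  moreover have "(\<Union>c<k. interleaved_pairs (P c))
      = {(e, f) \<in> interleaved_pairs (diagonals n). col e = col f}"
    using col by (auto simp: P_def interleaved_pairs_def)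
  ultimately have I: "card {(e, f) \<in> interleaved_pairs (diagonals n). col e = col f}
      = (\<Sum>c<k. card (interleaved_pairs (P c)))" by simp
  have "card (diagonals n) \<le> (\<Sum>c<k. card (interleaved_pairs (P c)) + (n - 3))"
    unfolding D by (intro sum_mono card_le_interleaved_pairs assms) (auto simp: P_def)
  then have "card (diagonals n)
      \<le> card {(e, f) \<in> interleaved_pairs (diagonals n). col e = col f} + k * (n - 3)"
    by (simp add: I sum.distrib)
  then have "n * (n - 3)
      \<le> 2 * card {(e, f) \<in> interleaved_pairs (diagonals n). col e = col f} + 2 * (k * (n - 3))"
    using card_diagonals[OF assms(1)] by linarith
  then have "int (n * (n - 3))
      \<le> int (2 * card {(e, f) \<in> interleaved_pairs (diagonals n). col e = col f} + 2 * (k * (n - 3)))"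
    by (simp only: of_nat_le_iff)
  then show ?thesis by (simp add: algebra_simps)
qed

section \<open>The lower bound\<close>

text \<open>Both paths fit into a box standing on the real axis, with all four endpoints in
  interlaced order on its bottom side: the situation of \<open>fashoda_interlace\<close>.\<close>

lemma interleaved_arcs_meet:
  assumes c: "path c" "path d"
    and up: "\<And>z. z \<in> path_image c \<union> path_image d \<Longrightarrow> Im z \<ge> 0"
    and ends: "pathstart c = of_real x" "pathfinish c = of_real y"
      "pathstart d = of_real u" "pathfinish d = of_real v"
    and ord: "x < u" "u < y" "y < v"
  shows "path_image c \<inter> path_image d \<noteq> {}"
proof -
  \<comment> \<open>\<open>T\<close> carries the plane to \<open>real^2\<close>, where Fashoda's
    theorem is stated; injectivity carries the meeting point back.\<close>
  define T :: "complex \<Rightarrow> real^2" where "T z = (\<chi> i. if i = 1 then Re z else Im z)" for z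
  have T1: "T z $ 1 = Re z" and T2: "T z $ 2 = Im z" for z by (simp_all add: T_def)
  have contT: "continuous_on A T" for A
    unfolding T_def
    by (intro continuous_on_vec_lambda, case_tac "i = 1") (auto intro!: continuous_intros)
  have injT: "T z = T w \<Longrightarrow> z = w" for z w by (metis T1 T2 complex_eqI)
  have "bounded (path_image c \<union> path_image d)"
    using c by (simp add: bounded_path_image)
  then obtain B where B: "\<And>z. z \<in> path_image c \<union> path_image d \<Longrightarrow> norm z \<le> B"
    unfolding bounded_iff by blast
  have box: "T z \<in> cbox (vector [- B, 0]) (vector [B, B])" if "z \<in> path_image c \<union> path_image d" for z
    using B[OF that] up[OF that] abs_Re_le_cmod[of z] abs_Im_le_cmod[of z]
    by (auto simp: mem_box_cart forall_2 T1 T2)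
  obtain z where "z \<in> path_image (T \<circ> c)" "z \<in> path_image (T \<circ> d)"
  proof (rule fashoda_interlace[of "T \<circ> c" "T \<circ> d" "vector [- B, 0]" "vector [B, B]"])
    show "path (T \<circ> c)" "path (T \<circ> d)" using c contT by (auto intro: path_continuous_image)
    show "path_image (T \<circ> c) \<subseteq> cbox (vector [- B, 0]) (vector [B, B])"
      "path_image (T \<circ> d) \<subseteq> cbox (vector [- B, 0]) (vector [B, B])"
      using box by (auto simp: path_image_compose)
  qed (use ends ord in \<open>auto simp: pathstart_compose pathfinish_compose T1 T2\<close>)
  then show ?thesis using injT by (auto simp: path_image_compose)
qed

lemma path_image_open_interval: "path_image c = {pathstart c, pathfinish c} \<union> c ` {0<..<1}"
proof -
  have "{0..1::real} = {0, 1} \<union> {0<..<1}" by auto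
  then show ?thesis unfolding path_image_def pathstart_def pathfinish_def by auto
qed

text \<open>A drawing fixes only the set of the two ends of a curve. Reversing the curve if
  necessary makes it run from \<open>a\<close> to \<open>b\<close> with the same image.\<close>

lemma book_drawing_oriented_edge:
  assumes "book_drawing k V E D" "{a, b} \<in> E"
  obtains c where "path c" "pathstart c = of_real (spine_pos D a)"
    "pathfinish c = of_real (spine_pos D b)"
    "path_image c = {of_real (spine_pos D a), of_real (spine_pos D b)} \<union> edge_interior D {a, b}"
proof -
  let ?c = "curve D {a, b}"
  have p: "path ?c" using assms by (auto simp: book_drawing_def arc_def)
  have ends: "{pathstart ?c, pathfinish ?c} = {of_real (spine_pos D a), of_real (spine_pos D b)}"
    using assms unfolding book_drawing_def by (metis (no_types, lifting) image_empty image_insert)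
  have im: "path_image ?c
      = {of_real (spine_pos D a), of_real (spine_pos D b)} \<union> edge_interior D {a, b}"
    using path_image_open_interval[of ?c] ends by (simp only: edge_interior_def)
  show thesis
  proof (cases "pathstart ?c = of_real (spine_pos D a) \<and> pathfinish ?c = of_real (spine_pos D b)")
    case True
    then show thesis using that p im by blast
  next
    case False
    then have "pathstart ?c = of_real (spine_pos D b) \<and> pathfinish ?c = of_real (spine_pos D a)"
      using ends by (auto simp: doubleton_eq_iff)
    then show thesis using that[of "reversepath ?c"] p im by simp
  qed
qed

lemma book_drawing_interleaved_cross:
  assumes D: "book_drawing k V E D" and E: "{a, b} \<in> E" "{c, d} \<in> E"
    and page: "page_of D {a, b} = page_of D {c, d}"
    and ord: "spine_pos D a < spine_pos D c" "spine_pos D c < spine_pos D b"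
      "spine_pos D b < spine_pos D d"
  shows "\<exists>p. ({{a, b}, {c, d}}, p) \<in> crossings E D"
proof -
  let ?pos = "\<lambda>v. of_real (spine_pos D v) :: complex"
  obtain g where g: "path g" "pathstart g = ?pos a" "pathfinish g = ?pos b"
    "path_image g = {?pos a, ?pos b} \<union> edge_interior D {a, b}"
    using book_drawing_oriented_edge[OF D E(1)] .
  obtain h where h: "path h" "pathstart h = ?pos c" "pathfinish h = ?pos d"
    "path_image h = {?pos c, ?pos d} \<union> edge_interior D {c, d}"
    using book_drawing_oriented_edge[OF D E(2)] .
  have up: "Im z > 0" if "z \<in> edge_interior D {a, b} \<union> edge_interior D {c, d}" for z
    using D E that unfolding book_drawing_def by blast
  have "path_image g \<inter> path_image h \<noteq> {}"
  proof (rule interleaved_arcs_meet[OF g(1) h(1) _ g(2,3) h(2,3) ord])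
    show "Im z \<ge> 0" if "z \<in> path_image g \<union> path_image h" for z
      using that up[of z] unfolding g(4) h(4) by auto
  qed
  then obtain z where z: "z \<in> path_image g" "z \<in> path_image h" by blast
  \<comment> \<open>The meeting point is not an endpoint: the four endpoints are distinct and lie on
    the spine, while edge interiors lie strictly above it.\<close>
  have "{?pos a, ?pos b} \<inter> {?pos c, ?pos d} = {}" using ord by auto
  then have "z \<in> edge_interior D {a, b} \<inter> edge_interior D {c, d}"
    using z up[of z] unfolding g(4) h(4) by auto
  moreover have "{a, b} \<noteq> {c, d}" using ord by (auto simp: doubleton_eq_iff)
  ultimately show ?thesis using E page unfolding crossings_def by blast
qed

section \<open>From arbitrary book drawings to colored diagonals\<close>

text \<open>Used to renumber the vertices in their order along the spine, as on a convex
  polygon.\<close>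

lemma obtain_sorting_enumeration:
  fixes f :: "nat \<Rightarrow> real"
  assumes "inj_on f {..<n}"
  obtains v where "bij_betw v {..<n} {..<n}" "\<And>i j. i < j \<Longrightarrow> j < n \<Longrightarrow> f (v i) < f (v j)"
proof -
  define xs where "xs = sort_key f [0..<n]"
  have len: "length xs = n" and set: "set xs = {..<n}" and dist: "distinct xs"
    by (auto simp: xs_def)
  have sorted: "sorted (map f xs)" by (simp add: xs_def)
  have bij: "bij_betw ((!) xs) {..<n} {..<n}"
    using bij_betw_nth[OF dist] len set by simp
  have "f (xs ! i) < f (xs ! j)" if "i < j" "j < n" for i j
  proof -
    have "f (xs ! i) \<le> f (xs ! j)"
      using sorted_nth_mono[OF sorted, of i j] that len by simp
    moreover have "xs ! i \<noteq> xs ! j"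
      using that len dist by (simp add: nth_eq_iff_index_eq)
    moreover have "xs ! i \<in> {..<n}" "xs ! j \<in> {..<n}"
      using bij that by (auto dest: bij_betwE)
    ultimately show ?thesis using inj_onD[OF assms] by (metis order_le_less)
  qed
  then show thesis using that bij by blast
qed

text \<open>The pages color the diagonals of the renumbered polygon. Choosing one meeting point for
  each monochromatic interleaved pair embeds these pairs into the crossings of the drawing.\<close>

lemma card_crossings_ge:
  assumes n: "n \<ge> 3" and D: "book_drawing k {..<n} (complete_edges {..<n}) D"
  shows "int ((n - 3) * n) - int ((n - 3) * (2 * k))
    \<le> 2 * int (card (crossings (complete_edges {..<n}) D))"
proof -
  let ?E = "complete_edges {..<n}"
  obtain v where bij: "bij_betw v {..<n} {..<n}"
    and mono: "\<And>i j. i < j \<Longrightarrow> j < n \<Longrightarrow> spine_pos D (v i) < spine_pos D (v j)"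
    using obtain_sorting_enumeration D unfolding book_drawing_def by metis
  have inj: "v i = v j \<longleftrightarrow> i = j" if "i < n" "j < n" for i j
    using bij that by (auto simp: bij_betw_def inj_on_def)
  define ed where "ed e = {v (fst e), v (snd e)}" for e
  define X where "X = {(e, f) \<in> interleaved_pairs (diagonals n).
    page_of D (ed e) = page_of D (ed f)}"
  have diag: "fst e < snd e \<and> snd e < n" if "e \<in> diagonals n" for e
    using that by (auto simp: diagonals_def)
  have ed: "ed e \<in> ?E" if "e \<in> diagonals n" for e
    using diag[OF that] bij inj[of "fst e" "snd e"]
    by (auto simp: complete_edges_def ed_def dest: bij_betwE)
  have ed_inj: "e = f" if "e \<in> diagonals n" "f \<in> diagonals n" "ed e = ed f" for e f
    using diag[OF that(1)] diag[OF that(2)] that(3) inj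
    by (auto simp: ed_def doubleton_eq_iff prod_eq_iff)
  have "\<exists>p. ({ed (fst x), ed (snd x)}, p) \<in> crossings ?E D" if "x \<in> X" for x
  proof -
    obtain e f where x: "x = (e, f)" by (cases x)
    have ef: "e \<in> diagonals n" "f \<in> diagonals n" "interleaved e f"
      "page_of D (ed e) = page_of D (ed f)"
      using that by (auto simp: X_def x interleaved_pairs_def)
    show ?thesis
      using book_drawing_interleaved_cross[OF D, of "v (fst e)" "v (snd e)" "v (fst f)" "v (snd f)"]
        ed[OF ef(1)] ed[OF ef(2)] ef(3,4) diag[OF ef(1)] diag[OF ef(2)] mono
      by (simp add: x ed_def interleaved_def)
  qed
  then obtain P where P: "\<And>x. x \<in> X \<Longrightarrow> ({ed (fst x), ed (snd x)}, P x) \<in> crossings ?E D"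
    by metis
  have "inj_on (\<lambda>x. ({ed (fst x), ed (snd x)}, P x)) X"
  proof (rule inj_onI)
    fix x y assume xy: "x \<in> X" "y \<in> X"
      "({ed (fst x), ed (snd x)}, P x) = ({ed (fst y), ed (snd y)}, P y)"
    have *: "fst x \<in> diagonals n" "snd x \<in> diagonals n" "fst y \<in> diagonals n" "snd y \<in> diagonals n"
      "interleaved (fst x) (snd x)" "interleaved (fst y) (snd y)"
      using xy(1,2) by (auto simp: X_def interleaved_pairs_def)
    have "ed (fst x) = ed (fst y) \<and> ed (snd x) = ed (snd y)
        \<or> ed (fst x) = ed (snd y) \<and> ed (snd x) = ed (fst y)"
      using xy(3) by (auto simp: doubleton_eq_iff)
    then have "fst x = fst y \<and> snd x = snd y \<or> fst x = snd y \<and> snd x = fst y"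
      using ed_inj * by metis
    \<comment> \<open>The swapped alternative is impossible, because in both pairs the first
      diagonal starts first.\<close>
    then show "x = y" using *(5,6) by (auto simp: interleaved_def prod_eq_iff)
  qed
  then have "card X \<le> card (crossings ?E D)"
    using P D by (intro card_inj_on_le) (auto simp: book_drawing_def)
  moreover have "int ((n - 3) * n) - int ((n - 3) * (2 * k)) \<le> 2 * int (card X)"
    unfolding X_def
    using D ed by (intro card_monochromatic_ge[OF n, of "\<lambda>e. page_of D (ed e)"])
      (simp add: book_drawing_def)
  ultimately show ?thesis by linarith
qed

section \<open>Semicircles\<close>

text \<open>For \<open>x < y\<close>, the upper semicircle over the segment from \<open>x\<close> to
  \<open>y\<close>, run counterclockwise: it starts at \<open>y\<close> and ends at
  \<open>x\<close>.\<close>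

definition semicircle :: "real \<Rightarrow> real \<Rightarrow> real \<Rightarrow> complex" where
  "semicircle x y t = Complex ((x + y) / 2 + (y - x) / 2 * cos (pi * t)) ((y - x) / 2 * sin (pi * t))"

lemma arc_semicircle:
  assumes "x < y"
  shows "arc (semicircle x y)"
  unfolding arc_def
proof
  show "path (semicircle x y)"
    unfolding path_def semicircle_def complex_eq by (intro continuous_intros)
  show "inj_on (semicircle x y) {0..1}"
  proof (rule inj_onI)
    fix s t :: real assume st: "s \<in> {0..1}" "t \<in> {0..1}" "semicircle x y s = semicircle x y t"
    then have "cos (pi * s) = cos (pi * t)" using assms by (simp add: semicircle_def)
    moreover have "0 \<le> pi * s" "pi * s \<le> pi" "0 \<le> pi * t" "pi * t \<le> pi"
      using st by (simp_all add: mult_left_le)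
    ultimately have "pi * s = pi * t" by (rule cos_inj_pi[rotated 4])
    then show "s = t" by simp
  qed
qed

lemma semicircle_ends:
  "pathstart (semicircle x y) = of_real y" "pathfinish (semicircle x y) = of_real x"
  by (auto simp: semicircle_def pathstart_def pathfinish_def complex_eq_iff field_simps)

text \<open>The equation is the geometric mean theorem for a circle with diameter from
  \<open>x\<close> to \<open>y\<close>. Without center and radius, two such circles are easy to
  compare.\<close>

lemma semicircle_interior:
  assumes "x < y" "z \<in> semicircle x y ` {0<..<1}"
  shows "Im z > 0" "(Re z - x) * (y - Re z) = (Im z)\<^sup>2"
proof -
  obtain t where t: "0 < t" "t < 1" "z = semicircle x y t" using assms by auto
  have "sin (pi * t) > 0" using t by (intro sin_gt_zero) auto
  then show "Im z > 0" using assms t by (simp add: semicircle_def)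
  have "(Re z - x) * (y - Re z) = ((y - x) / 2)\<^sup>2 * (1 - (cos (pi * t))\<^sup>2)"
    by (simp add: t semicircle_def power2_eq_square field_simps)
  also have "\<dots> = (Im z)\<^sup>2"
    by (simp add: t semicircle_def power_mult_distrib power_divide sin_squared_eq)
  finally show "(Re z - x) * (y - Re z) = (Im z)\<^sup>2" .
qed

text \<open>Here \<open>r\<close> and \<open>q\<close> are the real part and the squared imaginary
  part of a common point. If one of the distinct intervals contained the other, its product would be
  strictly larger; as both contain \<open>r\<close>, they must interleave.\<close>

lemma semicircles_meet_interleaved:
  fixes x y u v r q :: real
  assumes "x < y" "u < v" "q > 0" and xy: "(r - x) * (y - r) = q" and uv: "(r - u) * (v - r) = q"
    and ne: "(x, y) \<noteq> (u, v)"
  shows "x < u \<and> u < y \<and> y < v \<or> u < x \<and> x < v \<and> v < y"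
proof -
  have between: "a < r \<and> r < b" if "a < b" "(r - a) * (b - r) = q" for a b
    using that \<open>q > 0\<close> by (smt (verit) zero_less_mult_iff)
  note xr = between[OF \<open>x < y\<close> xy] between[OF \<open>u < v\<close> uv]
  have nested: "b < d" if "a < c" "a < r" "c < r" "r < b" "r < d"
    "(r - a) * (b - r) = (r - c) * (d - r)" for a b c d
  proof (rule ccontr)
    assume "\<not> b < d"
    have "(r - c) * (d - r) < (r - a) * (d - r)"
      using that by (intro mult_strict_right_mono) auto
    also have "\<dots> \<le> (r - a) * (b - r)"
      using that \<open>\<not> b < d\<close> by (intro mult_left_mono) auto
    finally show False using that by simp
  qed
  consider "x < u" | "u < x" | "x = u" by linarith
  then show ?thesis
  proof cases
    case 1
    then show ?thesis using nested[of x u y v] xr xy uv by auto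
  next
    case 2
    then show ?thesis using nested[of u x v y] xr xy uv by auto
  next
    case 3
    then have "(r - x) * (y - r) = (r - x) * (v - r)" using xy uv by simp
    then show ?thesis using xr ne 3 by simp
  qed
qed

text \<open>\<open>r\<close> is the abscissa of the radical axis, where the two circle equations
  have a linear difference that vanishes.\<close>

definition semicircles_point :: "real \<Rightarrow> real \<Rightarrow> real \<Rightarrow> real \<Rightarrow> complex" where
  "semicircles_point x y u v =
    (let r = (u * v - x * y) / (u + v - x - y) in Complex r (sqrt ((r - x) * (y - r))))"

text \<open>Makes the crossing point a function of the two edges, so each pair contributes at most
  one crossing.\<close>

lemma semicircles_point_unique:
  assumes "x < u" "y < v" "Im z > 0"
    and xy: "(Re z - x) * (y - Re z) = (Im z)\<^sup>2" and uv: "(Re z - u) * (v - Re z) = (Im z)\<^sup>2"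
  shows "z = semicircles_point x y u v"
proof -
  have "(Re z - x) * (y - Re z) = (Re z - u) * (v - Re z)" using xy uv by simp
  then have "Re z * (u + v - x - y) = u * v - x * y" by (simp add: algebra_simps)
  moreover have "u + v - x - y \<noteq> 0" using assms(1,2) by simp
  ultimately have "Re z = (u * v - x * y) / (u + v - x - y)" by (simp add: eq_divide_eq)
  moreover have "Im z = sqrt ((Re z - x) * (y - Re z))" using xy \<open>Im z > 0\<close> by simp
  ultimately show ?thesis by (simp add: semicircles_point_def complex_eq_iff Let_def)
qed

section \<open>Blocks of parallel classes\<close>

text \<open>
  The parallel classes \<open>0, \<dots>, 3 * a - 1\<close> are grouped into \<open>a\<close> blocks of length three, the later ones
  into blocks of length two.
\<close>

definition block :: "nat \<Rightarrow> nat \<Rightarrow> nat" where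
  "block a c = (if c < 3 * a then c div 3 else a + (c - 3 * a) div 2)"

lemma block_less:
  assumes "c < 3 * a + 2 * b"
  shows "block a c < a + b"
proof (cases "c < 3 * a")
  case True
  then have "c div 3 < a" by (simp add: less_mult_imp_div_less mult.commute)
  then show ?thesis using True by (simp add: block_def)
next
  case False
  then have "c - 3 * a < b * 2" using assms by linarith
  then have "(c - 3 * a) div 2 < b" by (rule less_mult_imp_div_less)
  then show ?thesis using False by (simp add: block_def)
qed

text \<open>Two classes at distance at least two do not fit into a block of length two; in a block
  of length three they are its first and last class.\<close>

lemma block_eqD:
  assumes "block a c = block a d" "c + 2 \<le> d"
  shows "d = c + 2" "\<exists>x<a. c = 3 * x"
proof -
  have "d < 3 * a"
  proof (rule ccontr)
    assume d: "\<not> d < 3 * a"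
    show False
    proof (cases "c < 3 * a")
      case True
      then have "c div 3 < a" by (simp add: less_mult_imp_div_less mult.commute)
      then show False using assms(1) d True by (simp add: block_def)
    next
      case False
      then have "(c - 3 * a) div 2 = (d - 3 * a) div 2" using assms d by (simp add: block_def)
      moreover have "c - 3 * a + 2 \<le> d - 3 * a" using assms(2) False by linarith
      then have "(c - 3 * a) div 2 + 1 \<le> (d - 3 * a) div 2"
        using div_le_mono[of "c - 3 * a + 2" "d - 3 * a" 2] by simp
      ultimately show False by simp
    qed
  qed
  then have *: "c < 3 * a" "c div 3 = d div 3" using assms by (auto simp: block_def)
  have "d = 3 * (d div 3) + d mod 3" "c = 3 * (c div 3) + c mod 3" "d mod 3 < 3"
    by simp_all
  then have "d = c + 2 \<and> c = 3 * (c div 3)" using assms(2) *(2) by linarith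
  moreover from this have "c div 3 < a" using *(1) by linarith
  ultimately show "d = c + 2" "\<exists>x<a. c = 3 * x" by blast+
qed

text \<open>
  In the block of the classes \<open>c, c + 1, c + 2\<close> a diagonal of class \<open>c\<close> crosses only its rotation by one
  step. The pair starting at \<open>i\<close> has \<open>i + j = c\<close> if \<open>i < c\<close> and \<open>i + j = c + n\<close> otherwise; for
  \<open>i = c + 1\<close> the endpoint \<open>n - 1\<close> wraps around to \<open>0\<close>, so that the two diagonals change places.
\<close>

definition crossed_starts :: "nat \<Rightarrow> nat \<Rightarrow> nat set" where
  "crossed_starts n c = {..<c div 2} \<union> {c + 1..<(c + n) div 2}"

definition crossed_pair :: "nat \<Rightarrow> nat \<Rightarrow> nat \<Rightarrow> (nat \<times> nat) \<times> (nat \<times> nat)" where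
  "crossed_pair n c i =
    (if i < c then ((i, c - i), (i + 1, c - i + 1))
     else if i = c + 1 then ((0, c + 2), (c + 1, n - 1))
     else ((i, c + n - i), (i + 1, c + n - i + 1)))"

lemma monochromatic_interleavedD:
  assumes n: "3 * a \<le> n" "n \<ge> 3" and int: "interleaved (i, j) (i', j')" and "j' < n"
    and page: "block a ((i + j) mod n) = block a ((i' + j') mod n)"
  shows "\<exists>x<a. \<exists>l \<in> crossed_starts n (3 * x). ((i, j), (i', j')) = crossed_pair n (3 * x) l"
proof -
  have ord: "i < i'" "i' < j" "j < j'" using int by (auto simp: interleaved_def)
  define c d where "c = (i + j) mod n" and "d = (i' + j') mod n"
  have md: "s mod n = (if s < n then s else s - n)" if "s < 2 * n" for s
    using that by (simp add: mod_if)
  have c: "c = (if i + j < n then i + j else i + j - n)"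
    unfolding c_def using ord \<open>j' < n\<close> by (intro md) simp
  have d: "d = (if i' + j' < n then i' + j' else i' + j' - n)"
    unfolding d_def using ord \<open>j' < n\<close> by (intro md) simp
  \<comment> \<open>The sums \<open>i' + j'\<close> and \<open>i + j\<close> differ by at least 2
    and, since \<open>i' < j\<close> and \<open>j' < n\<close>, by at most \<open>n - 2\<close>; so
    the residues also differ by at least two.\<close>
  have "c + 2 \<le> d \<or> d + 2 \<le> c" using ord \<open>j' < n\<close> c d by (auto split: if_splits)
  then show ?thesis
  proof
    assume le: "c + 2 \<le> d"
    note blk = block_eqD[OF page[folded c_def d_def] le]
    then obtain x where x: "x < a" "c = 3 * x" by blast
    have "i' = i + 1 \<and> j' = j + 1 \<and> i + 2 \<le> j"
      using ord \<open>j' < n\<close> c d blk(1) by (auto split: if_splits)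
    moreover have "c + 3 \<le> n" using x n by linarith
    ultimately have "i \<in> crossed_starts n c \<and> ((i, j), (i', j')) = crossed_pair n c i"
      using c ord \<open>j' < n\<close> by (auto simp: crossed_starts_def crossed_pair_def split: if_splits)
    then show ?thesis using x by blast
  next
    assume le: "d + 2 \<le> c"
    note blk = block_eqD[OF page[folded c_def d_def, symmetric] le]
    then obtain x where x: "x < a" "d = 3 * x" by blast
    \<comment> \<open>Here only the second sum is reduced modulo \<open>n\<close>, and the
      difference of the sums is exactly the maximum \<open>n - 2\<close>. This forces the extreme
      values.\<close>
    have "i = 0 \<and> j' = n - 1 \<and> j = i' + 1 \<and> i' = d + 1 \<and> d + 4 \<le> n"
      using ord \<open>j' < n\<close> c d blk(1) by (auto split: if_splits)
    then have "d + 1 \<in> crossed_starts n d \<and> ((i, j), (i', j')) = crossed_pair n d (d + 1)"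
      by (auto simp: crossed_starts_def crossed_pair_def)
    then show ?thesis using x by blast
  qed
qed

text \<open>For odd \<open>n\<close> every block has \<open>(n - 3) / 2\<close> crossed starts. For
  even \<open>n\<close> a block has \<open>(n - 2) / 2\<close> or \<open>(n - 4) / 2\<close> of
  them, as its first class is even or odd; then \<open>a\<close> is even too, and consecutive blocks
  pair up to \<open>n - 3\<close>.\<close>

lemma sum_card_crossed_starts:
  assumes n: "3 * a \<le> n" "n \<ge> 3" and "even (n - a)"
  shows "2 * (\<Sum>x<a. card (crossed_starts n (3 * x))) = a * (n - 3)"
proof -
  have card: "card (crossed_starts n c) = c div 2 + ((c + n) div 2 - (c + 1))" for c
    unfolding crossed_starts_def by (subst card_Un_disjoint) auto
  have half: "(2 * m) div 2 = m" "(2 * m + 1) div 2 = m" for m :: nat by simp_all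
  show ?thesis
  proof (cases "even n")
    case False
    have "2 * card (crossed_starts n (3 * x)) = n - 3" if "x < a" for x
    proof -
      have le: "3 * x + 3 \<le> n" using that n by linarith
      obtain N where N: "n = 2 * N + 1" using False by (rule oddE)
      show ?thesis
      proof (cases "even x")
        case True
        then obtain y where "x = 2 * y" by (rule evenE)
        then have "3 * x = 2 * (3 * y)" "3 * x + n = 2 * (3 * y + N) + 1" using N by simp_all
        then have "card (crossed_starts n (3 * x)) = 3 * y + (3 * y + N - (2 * (3 * y) + 1))"
          unfolding card by (simp only: half)
        then show ?thesis using le N \<open>x = 2 * y\<close> by simp
      next
        case False
        then obtain y where "x = 2 * y + 1" by (rule oddE)
        then have "3 * x = 2 * (3 * y + 1) + 1" "3 * x + n = 2 * (3 * y + N + 2)" using N by simp_all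
        then have "card (crossed_starts n (3 * x))
            = 3 * y + 1 + (3 * y + N + 2 - (2 * (3 * y + 1) + 1 + 1))"
          unfolding card by (simp only: half)
        then show ?thesis using le N \<open>x = 2 * y + 1\<close> by simp
      qed
    qed
    then show ?thesis by (simp add: sum_distrib_left)
  next
    case True
    then have "even a" using assms(3) n by (auto simp: even_diff_nat)
    then obtain b where b: "a = 2 * b" by (rule evenE)
    have "(\<Sum>x<2 * m. card (crossed_starts n (3 * x))) = m * (n - 3)" if "m \<le> b" for m
      using that
    proof (induction m)
      case 0
      then show ?case by simp
    next
      case (Suc m)
      have "6 * m + 6 \<le> n" using Suc.prems b n by linarith
      moreover obtain N where "n = 2 * N" using True by (rule evenE)
      moreover from this have "3 * (2 * m) = 2 * (3 * m)" "3 * (2 * m) + n = 2 * (3 * m + N)"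
        "3 * (2 * m + 1) = 2 * (3 * m + 1) + 1" "3 * (2 * m + 1) + n = 2 * (3 * m + N + 1) + 1"
        by simp_all
      ultimately have "card (crossed_starts n (3 * (2 * m)))
          + card (crossed_starts n (3 * (2 * m + 1))) = n - 3"
        unfolding card by (simp only: half) simp
      then show ?case using Suc by simp
    qed
    from this[of b] show ?thesis by (simp add: b)
  qed
qed

section \<open>The upper bound\<close>

text \<open>An edge is an unordered set; \<open>Min\<close> and \<open>Max\<close> recover its
  endpoints, whose sum modulo \<open>n\<close> is its parallel class.\<close>

definition cyclic_drawing :: "nat \<Rightarrow> nat \<Rightarrow> nat drawing" where
  "cyclic_drawing a n =
    \<lparr>spine_pos = real, page_of = (\<lambda>e. block a ((Min e + Max e) mod n)),
     curve = (\<lambda>e. semicircle (real (Min e)) (real (Max e)))\<rparr>"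

lemma cyclic_drawing_sel:
  assumes "i < j"
  shows "page_of (cyclic_drawing a n) {i, j} = block a ((i + j) mod n)"
    and "curve (cyclic_drawing a n) {i, j} = semicircle (real i) (real j)"
  using assms by (simp_all add: cyclic_drawing_def min_absorb1 max_absorb2)

lemma complete_edgesE:
  fixes e :: "nat set"
  assumes "e \<in> complete_edges {..<n}"
  obtains i j where "e = {i, j}" "i < j" "j < n"
proof -
  obtain x y where xy: "e = {x, y}" "x \<noteq> y" "x < n" "y < n"
    using assms by (auto simp: complete_edges_def card_2_iff)
  then show thesis using that[of x y] that[of y x] by (auto simp: insert_commute linorder_neq_iff)
qed

text \<open>A crossing of semicircles comes from interleaved endpoints, a common page restricts
  these to a \<open>crossed_pair\<close>, and the pair determines the point. The inclusion yields
  finiteness as well as the upper bound.\<close>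

lemma crossings_cyclic_drawing:
  assumes n: "3 * a \<le> n" "n \<ge> 3"
  defines "q \<equiv> (\<lambda>((i, j), (i', j')). ({{i, j}, {i', j'}},
      semicircles_point (real i) (real j) (real i') (real j')))"
  shows "crossings (complete_edges {..<n}) (cyclic_drawing a n)
    \<subseteq> (\<lambda>(x, l). q (crossed_pair n (3 * x) l)) ` (SIGMA x:{..<a}. crossed_starts n (3 * x))"
    (is "?C \<subseteq> ?R")
proof -
  let ?D = "cyclic_drawing a n"
  \<comment> \<open>Treats the case that the first edge starts first; the other case follows by
    exchanging the edges, as crossings record them as an unordered pair.\<close>
  have main: "({{i, j}, {i', j'}}, z) \<in> ?R"
    if "interleaved (i, j) (i', j')" "j' < n" "page_of ?D {i, j} = page_of ?D {i', j'}"
      "z \<in> edge_interior ?D {i, j}" "z \<in> edge_interior ?D {i', j'}" for i j i' j' z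
  proof -
    have ord: "i < i'" "i' < j" "j < j'" "i < j" "i' < j'"
      using that(1) by (auto simp: interleaved_def)
    have z: "z \<in> semicircle (real i) (real j) ` {0<..<1}"
      "z \<in> semicircle (real i') (real j') ` {0<..<1}"
      using that(4,5) ord by (simp_all add: edge_interior_def cyclic_drawing_sel)
    have "z = semicircles_point (real i) (real j) (real i') (real j')"
      using semicircle_interior[OF _ z(1)] semicircle_interior[OF _ z(2)] ord
      by (intro semicircles_point_unique) simp_all
    then have q: "({{i, j}, {i', j'}}, z) = q ((i, j), (i', j'))" by (simp add: q_def)
    have "block a ((i + j) mod n) = block a ((i' + j') mod n)"
      using that(3) ord by (simp add: cyclic_drawing_sel)
    from monochromatic_interleavedD[OF n that(1,2) this]
    obtain x l where "x < a" "l \<in> crossed_starts n (3 * x)"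
      "((i, j), (i', j')) = crossed_pair n (3 * x) l" by blast
    then show ?thesis unfolding q by force
  qed
  show ?thesis
  proof
    fix w assume "w \<in> ?C"
    then obtain e f z where w: "w = ({e, f}, z)" and E: "e \<in> complete_edges {..<n}"
        "f \<in> complete_edges {..<n}" and "e \<noteq> f" and page: "page_of ?D e = page_of ?D f"
      and z: "z \<in> edge_interior ?D e" "z \<in> edge_interior ?D f"
      unfolding crossings_def by blast
    obtain i j where e: "e = {i, j}" "i < j" "j < n" using complete_edgesE[OF E(1)] .
    obtain i' j' where f: "f = {i', j'}" "i' < j'" "j' < n" using complete_edgesE[OF E(2)] .
    have zs: "z \<in> semicircle (real i) (real j) ` {0<..<1}"
      "z \<in> semicircle (real i') (real j') ` {0<..<1}"
      using z e f by (simp_all add: edge_interior_def cyclic_drawing_sel)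
    have "real i < real i' \<and> real i' < real j \<and> real j < real j'
        \<or> real i' < real i \<and> real i < real j' \<and> real j' < real j"
      using semicircle_interior[OF _ zs(1)] semicircle_interior[OF _ zs(2)] e f \<open>e \<noteq> f\<close>
      by (intro semicircles_meet_interleaved[where q = "(Im z)\<^sup>2" and r = "Re z"]) auto
    then have "interleaved (i, j) (i', j') \<or> interleaved (i', j') (i, j)"
      by (simp add: interleaved_def)
    then show "w \<in> ?R"
      using main[of i j i' j' z] main[of i' j' i j z] page z e f
      by (auto simp: w insert_commute)
  qed
qed

lemma cyclic_drawing_optimal:
  assumes n: "n \<ge> 3" and ab: "n = 3 * a + 2 * b"
  shows "book_drawing (a + b) {..<n} (complete_edges {..<n}) (cyclic_drawing a n)"
    and "2 * card (crossings (complete_edges {..<n}) (cyclic_drawing a n)) \<le> a * (n - 3)"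
proof -
  let ?E = "complete_edges {..<n}" and ?D = "cyclic_drawing a n"
  let ?W = "SIGMA x:{..<a}. crossed_starts n (3 * x)"
  have le: "3 * a \<le> n" using ab by simp
  note sub = crossings_cyclic_drawing[OF le n]
  have finW: "finite ?W" by (auto simp: crossed_starts_def)
  have fin: "finite (crossings ?E ?D)" using sub finW finite_surj by blast
  have "card (crossings ?E ?D) \<le> card ?W" using surj_card_le[OF finW sub] .
  also have "\<dots> = (\<Sum>x<a. card (crossed_starts n (3 * x)))"
    by (rule card_SigmaI) (auto simp: crossed_starts_def)
  finally show "2 * card (crossings ?E ?D) \<le> a * (n - 3)"
    using sum_card_crossed_starts[OF le n] ab by simp
  show "book_drawing (a + b) {..<n} ?E ?D"
    unfolding book_drawing_def
  proof (intro conjI ballI fin)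
    show "inj_on (spine_pos ?D) {..<n}" by (simp add: cyclic_drawing_def)
    fix e assume "e \<in> ?E"
    then obtain i j where e: "e = {i, j}" "i < j" "j < n" by (rule complete_edgesE)
    show "page_of ?D e < a + b"
    proof -
      have "(i + j) mod n < 3 * a + 2 * b" unfolding ab[symmetric] using n by simp
      then show ?thesis using e by (simp add: cyclic_drawing_sel block_less)
    qed
    show "arc (curve ?D e)" using e by (simp add: cyclic_drawing_sel arc_semicircle)
    show "{pathstart (curve ?D e), pathfinish (curve ?D e)}
        = (\<lambda>v. of_real (spine_pos ?D v)) ` e"
      using e by (simp add: cyclic_drawing_sel semicircle_ends insert_commute)
        (simp add: cyclic_drawing_def)
    show "edge_interior ?D e \<subseteq> {z. Im z > 0}"
      using e semicircle_interior(1)[of "real i" "real j"]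
      by (auto simp: edge_interior_def cyclic_drawing_sel)
  qed
qed

theorem theorem9:
  fixes k n :: nat
  assumes "k > 0" and "n > 0"
    and "2 < real n / real k" and "real n / real k \<le> 3"
  shows "real (nu_complete k n) = 1 / 2 * (real n - 3) * (real n - 2 * real k)"
proof -
  let ?E = "complete_edges {..<n}"
  let ?P = "\<lambda>m. \<exists>D. book_drawing k {..<n} ?E D \<and> card (crossings ?E D) = m"
  have "real (2 * k) < real n" "real n \<le> real (3 * k)"
    using assms by (simp_all add: field_simps)
  then have nk: "2 * k < n" "n \<le> 3 * k" by linarith+
  then have n: "n \<ge> 3" using assms(1) by linarith
  \<comment> \<open>The solution of \<open>3 * a + 2 * b = n\<close> and \<open>a + b = k\<close>;
    the two bounds on \<open>n / k\<close> ensure that neither subtraction is truncated.\<close>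
  define a b where "a = n - 2 * k" and "b = 3 * k - n"
  have ab: "n = 3 * a + 2 * b" "a + b = k" using nk by (simp_all add: a_def b_def)
  note opt = cyclic_drawing_optimal[OF n ab(1), unfolded ab(2)]
  have "?P (card (crossings ?E (cyclic_drawing a n)))" using opt(1) by blast
  then have nu: "?P (nu_complete k n)" "nu_complete k n \<le> card (crossings ?E (cyclic_drawing a n))"
    unfolding nu_complete_def book_crossing_number_def by (rule LeastI, rule Least_le)
  \<comment> \<open>The least value is attained by some drawing, to which the lower bound applies;
    since \<open>a = n - 2 * k\<close>, it equals the upper bound from the cyclic drawing.\<close>
  have "int ((n - 3) * n) - int ((n - 3) * (2 * k)) \<le> 2 * int (nu_complete k n)"
    using nu(1) card_crossings_ge[OF n] by metis
  moreover have "2 * nu_complete k n \<le> a * (n - 3)" using nu(2) opt(2) by linarith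
  moreover have "int (a * (n - 3)) = int ((n - 3) * n) - int ((n - 3) * (2 * k))"
  proof -
    have "int a = int n - 2 * int k" using nk by (simp add: a_def of_nat_diff)
    then show ?thesis by (simp only: of_nat_mult of_nat_numeral right_diff_distrib mult.commute)
  qed
  ultimately have "2 * nu_complete k n = a * (n - 3)" by linarith
  then have "2 * real (nu_complete k n) = real a * real (n - 3)"
    by (metis of_nat_mult of_nat_numeral)
  then show ?thesis using nk n by (simp add: a_def of_nat_diff mult.commute)
qed

end
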